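(* For $N\in\mathbb Z_{\geqslant1}$ and $\sigma\in\mathbb Z$, $$2\pi i \sum_{h/k \in \mathcal F_N} \operatorname{Res}_{z=h/k} Q(z;N,\sigma) = \begin{cases} -p_N(-\sigma) & \text{if } \sigma \leqslant 0, \\ 0 & \text{if } 0<\sigma<N(N+1)/2, \\ (-1)^N p_N \bigl(\sigma-N(N+1)/2 \bigr) & \text{if } N(N+1)/2 \leqslant \sigma. \end{cases}$$
   Context: $\mathcal{F}_N:=\{h/k : 1\leqslant k\leqslant N,\ 0\leqslant h<k,\ \gcd(h,k)=1\}$. $Q(z;N,\sigma):=e^{2\pi i\sigma z}\prod_{j=1}^N(1-e^{2\pi i j z})^{-1}$. $p_N(n)$ is the number of partitions of $n$ into at most $N$ parts. *)

theory Defs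
  imports "HOL-Complex_Analysis.Complex_Analysis" "HOL-Library.Multiset"
begin

text \<open>The Farey fractions of order \<open>N\<close> in \<open>[0,1)\<close>.\<close>

definition farey :: "nat \<Rightarrow> real set" where
  "farey N = {real h / real k | h k. 1 \<le> k \<and> k \<le> N \<and> h < k \<and> coprime h k}"

lemma finite_farey: "finite (farey N)"
proof (rule finite_subset)
  show "farey N \<subseteq> (\<lambda>(h, k). real h / real k) ` ({..N} \<times> {..N})"
    by (force simp: farey_def)
qed auto

text \<open>At a zero of the denominator \<open>Q\<close> takes the junk value \<open>0\<close>; this does not affect residues,
  which depend only on values in a punctured neighbourhood.\<close>

definition Q :: "nat \<Rightarrow> int \<Rightarrow> complex \<Rightarrow> complex" where
  "Q N \<sigma> z = exp (2 * of_real pi * \<i> * of_int \<sigma> * z)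
     * (\<Prod>j=1..N. inverse (1 - exp (2 * of_real pi * \<i> * of_nat j * z)))"

text \<open>A partition of \<open>n\<close> is a finite multiset of positive integers with sum \<open>n\<close>.\<close>

definition partitions_at_most :: "nat \<Rightarrow> nat \<Rightarrow> nat multiset set" where
  "partitions_at_most N n = {M. 0 \<notin># M \<and> size M \<le> N \<and> sum_mset M = n}"

definition p_at_most :: "nat \<Rightarrow> nat \<Rightarrow> nat" where
  "p_at_most N n = card (partitions_at_most N n)"

lemma finite_partitions_at_most: "finite (partitions_at_most N n)"
proof (rule finite_subset)
  have "\<exists>xs. set xs \<subseteq> {..n} \<and> length xs \<le> N \<and> M = mset xs"
    if M: "M \<in> partitions_at_most N n" for M
  proof -
    obtain xs where xs: "M = mset xs" by (metis ex_mset)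
    with M have "length xs \<le> N" "sum_list xs = n"
      by (auto simp: partitions_at_most_def sum_mset_sum_list)
    moreover from this(2) have "set xs \<subseteq> {..n}"
      using member_le_sum_list by fastforce
    ultimately show ?thesis using xs by blast
  qed
  then show "partitions_at_most N n \<subseteq> mset ` {xs. set xs \<subseteq> {..n} \<and> length xs \<le> N}"
    by blast
qed (simp add: finite_lists_length_le)

end

theory Submission
  imports Defs
begin

text \<open>
  Let \<open>S N \<sigma>\<close> be the left-hand side. Since \<open>Q N \<sigma> - Q N (\<sigma> + N) = Q (N - 1) \<sigma>\<close>, we have
  \<open>S N \<sigma> - S N (\<sigma> + N) = S (N - 1) \<sigma>\<close>. The right-hand side satisfies the same recurrence, because
  removing one from each part of a partition into exactly \<open>N\<close> parts gives
  \<open>p N n = p (N - 1) n + p N (n - N)\<close>. By induction on \<open>N\<close> the difference of the two sides is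
  \<open>N\<close>-periodic in \<open>\<sigma>\<close>, so it suffices to treat \<open>1 \<le> \<sigma> \<le> N\<close>. For \<open>N \<ge> 2\<close> these \<open>\<sigma>\<close> lie in the range
  \<open>0 < \<sigma> < N (N + 1) / 2\<close>, in which \<open>Q\<close> decays exponentially as \<open>Im z \<rightarrow> \<plusminus>\<infinity>\<close>; integrating the
  1-periodic function \<open>Q\<close> over a rectangle of width 1 and growing height gives \<open>S N \<sigma> = 0\<close>.
\<close>

section \<open>Partitions into at most \<open>N\<close> parts\<close>

lemma sum_mset_image_Suc: "sum_mset (image_mset Suc M) = sum_mset M + size M"
  by (induction M) auto

lemma p_at_most_0: "p_at_most 0 n = (if n = 0 then 1 else 0)"
proof -
  have "partitions_at_most 0 n = (if n = 0 then {{#}} else {})"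
    by (auto simp: partitions_at_most_def)
  then show ?thesis by (simp add: p_at_most_def)
qed

text \<open>Subtracting one loses exactly the parts equal to 1: they become 0 and are filtered out.
  The drop in size counts them, so they can be restored.\<close>

lemma mset_split_ones:
  fixes M :: "nat multiset"
  assumes "0 \<notin># M"
  shows "image_mset Suc (filter_mset (\<lambda>x. x \<noteq> 0) (image_mset (\<lambda>x. x - 1) M))
    + replicate_mset (size M - size (filter_mset (\<lambda>x. x \<noteq> 0) (image_mset (\<lambda>x. x - 1) M))) 1 = M"
  using assms
proof (induction M)
  case (add x M)
  have le: "size (filter_mset (\<lambda>x. x \<noteq> 0) (image_mset (\<lambda>x. x - 1) M)) \<le> size M"
    by (metis size_filter_mset_lesseq size_image_mset)
  from add show ?case using le by (cases "x = 1") (auto simp: Suc_diff_le)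
qed simp

lemma p_at_most_Suc:
  "p_at_most (Suc N) n =
    p_at_most N n + (if n < Suc N then 0 else p_at_most (Suc N) (n - Suc N))"
proof -
  define B where "B = {M. 0 \<notin># M \<and> size M = Suc N \<and> sum_mset M = n}"
  have split: "partitions_at_most (Suc N) n = partitions_at_most N n \<union> B"
    by (auto simp: partitions_at_most_def B_def)
  have finB: "finite B"
    using finite_partitions_at_most[of "Suc N" n] split by simp
  have "partitions_at_most N n \<inter> B = {}"
    by (auto simp: partitions_at_most_def B_def)
  with split finB have card: "p_at_most (Suc N) n = p_at_most N n + card B"
    by (simp add: p_at_most_def card_Un_disjoint finite_partitions_at_most)
  define g :: "nat multiset \<Rightarrow> nat multiset"
    where "g = (\<lambda>M. filter_mset (\<lambda>x. x \<noteq> 0) (image_mset (\<lambda>x. x - 1) M))"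
  \<comment> \<open>The inverse of \<open>g\<close> on \<open>B\<close>: padding with zeros to
    exactly \<open>Suc N\<close> entries and then adding one to each turns the zeros into
    ones.\<close>
  define f :: "nat multiset \<Rightarrow> nat multiset"
    where "f = (\<lambda>M. image_mset Suc M + replicate_mset (Suc N - size M) 1)"
  have fg: "f (g M) = M" if "M \<in> B" for M
    using mset_split_ones[of M] that by (simp add: B_def f_def g_def)
  have size_g: "size (g M) \<le> size M" for M
    unfolding g_def by (metis size_filter_mset_lesseq size_image_mset)
  have sum_f: "sum_mset (f M) = sum_mset M + Suc N" if "size M \<le> Suc N" for M
    using that by (simp add: f_def sum_mset_image_Suc)
  have gf: "g (f M) = M" if "0 \<notin># M" for M
  proof -
    have "filter_mset (\<lambda>x. x \<noteq> 0) M = M"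
      using that by (auto simp: filter_mset_eq_conv intro!: gr0I)
    then show ?thesis
      by (simp add: f_def g_def image_mset.compositionality o_def)
  qed
  have sum_B: "n = sum_mset (g M) + Suc N" if "M \<in> B" for M
    using sum_f[of "g M"] fg[OF that] size_g[of M] that by (simp add: B_def)
  show ?thesis
  proof (cases "n < Suc N")
    case True
    then have "B = {}" using sum_B by fastforce
    with True show ?thesis by (simp add: card)
  next
    case False
    have "bij_betw f (partitions_at_most (Suc N) (n - Suc N)) B"
    proof (rule bij_betw_byWitness[where f' = g])
      show "\<forall>M\<in>partitions_at_most (Suc N) (n - Suc N). g (f M) = M"
        using gf by (auto simp: partitions_at_most_def)
      show "\<forall>M\<in>B. f (g M) = M" using fg by blast
      show "f ` partitions_at_most (Suc N) (n - Suc N) \<subseteq> B"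
        using False sum_f by (auto simp: partitions_at_most_def B_def f_def split: if_splits)
      show "g ` B \<subseteq> partitions_at_most (Suc N) (n - Suc N)"
      proof (intro image_subsetI)
        fix M assume M: "M \<in> B"
        have "0 \<notin># g M" by (simp add: g_def)
        with sum_B[OF M] size_g[of M] M show "g M \<in> partitions_at_most (Suc N) (n - Suc N)"
          by (simp add: partitions_at_most_def B_def)
      qed
    qed
    from bij_betw_same_card[OF this] False card show ?thesis
      by (simp add: p_at_most_def)
  qed
qed

lemma p_at_most_1: "p_at_most 1 n = 1"
  by (induction n) (use p_at_most_Suc[of 0] p_at_most_0 in auto)

section \<open>Recurrence for the right-hand side\<close>

text \<open>Integer-valued, so that the recurrence can be checked before anything is cast to the
  complex numbers. The division by 2 is exact.\<close>

definition residue_value :: "nat \<Rightarrow> int \<Rightarrow> int" where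
  "residue_value N \<sigma> =
    (if \<sigma> \<le> 0 then - int (p_at_most N (nat (- \<sigma>)))
     else if \<sigma> < int N * (int N + 1) div 2 then 0
     else (-1) ^ N * int (p_at_most N (nat (\<sigma> - int N * (int N + 1) div 2))))"

text \<open>For \<open>N = 1\<close> the upper threshold is 1, so the middle range is empty and both
  outer branches give -1.\<close>

lemma residue_value_1: "residue_value 1 \<sigma> = -1"
  by (simp add: residue_value_def p_at_most_1[simplified])

lemma residue_value_diff:
  assumes "N \<ge> 1"
  shows "residue_value (Suc N) \<sigma> - residue_value (Suc N) (\<sigma> + int (Suc N)) = residue_value N \<sigma>"
proof -
  define m where "m = int N * (int N + 1) div 2"
  have m': "int (Suc N) * (int (Suc N) + 1) div 2 = m + int (Suc N)"
  proof -
    have "int (Suc N) * (int (Suc N) + 1) = int N * (int N + 1) + int (Suc N) * 2"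
      by (simp add: algebra_simps)
    then show ?thesis unfolding m_def by simp
  qed
  \<comment> \<open>This keeps the ranges apart: for \<sigma> \<le> 0 the shifted argument stays
    below the upper threshold m + N + 1.\<close>
  have m_pos: "m \<ge> 1"
  proof -
    have "int N * (int N + 1) \<ge> 1 * (1 + 1)"
      by (intro mult_mono) (use assms in auto)
    then have "int N * (int N + 1) \<ge> 2" by simp
    then show ?thesis unfolding m_def by linarith
  qed
  have rec: "int (p_at_most N (nat k)) = int (p_at_most (Suc N) (nat k)) -
      (if k < int (Suc N) then 0 else int (p_at_most (Suc N) (nat (k - int (Suc N)))))"
    if "k \<ge> 0" for k
    using p_at_most_Suc[of N "nat k"] that by (auto simp: nat_diff_distrib' nat_less_iff simp del: of_nat_Suc)
  \<comment> \<open>The thresholds for N + 1 are 0 and m + N + 1; shifting \<sigma> by N + 1 moves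
    them to -(N + 1) and m. Between consecutive cut points no term changes its branch.\<close>
  consider "\<sigma> \<le> - int (Suc N)" | "\<sigma> > - int (Suc N)" "\<sigma> \<le> 0" | "\<sigma> > 0" "\<sigma> < m"
    | "\<sigma> \<ge> m" "\<sigma> < m + int (Suc N)" | "\<sigma> \<ge> m + int (Suc N)" by linarith
  then show ?thesis
  proof cases
    case 1
    with rec[of "-\<sigma>"] show ?thesis
      by (simp add: residue_value_def diff_conv_add_uminus[symmetric] add.commute del: of_nat_Suc)
  next
    case 2
    with rec[of "-\<sigma>"] m_pos show ?thesis
      by (simp add: residue_value_def m' del: of_nat_Suc flip: m_def)
  next
    case 3
    then show ?thesis
      by (simp add: residue_value_def m' del: of_nat_Suc flip: m_def)
  next
    case 4
    with rec[of "\<sigma> - m"] m_pos show ?thesis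
      by (simp add: residue_value_def m' del: of_nat_Suc flip: m_def)
  next
    case 5
    then have "int (p_at_most N (nat (\<sigma> - m))) = int (p_at_most (Suc N) (nat (\<sigma> - m)))
        - int (p_at_most (Suc N) (nat (\<sigma> - (m + int (Suc N)))))"
      using rec[of "\<sigma> - m"] by (simp add: diff_diff_add del: of_nat_Suc)
    with 5 m_pos show ?thesis
      by (simp add: residue_value_def m' right_diff_distrib del: of_nat_Suc flip: m_def)
  qed
qed

text \<open>For N \<ge> 2 the threshold is at least 3N/2 > N, so a full period 1, ..., N lies in the
  vanishing range. For N = 1 this fails, which forces a separate base case.\<close>

lemma residue_value_middle:
  assumes "N \<ge> 2" "1 \<le> \<sigma>" "\<sigma> \<le> int N"
  shows "\<sigma> < int N * (int N + 1) div 2" "residue_value N \<sigma> = 0"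
proof -
  have "int N * (int N + 1) \<ge> int N * 3"
    by (intro mult_left_mono) (use assms in auto)
  then have "int N * (int N + 1) div 2 > int N"
    using assms by linarith
  with assms show "\<sigma> < int N * (int N + 1) div 2" by linarith
  with assms show "residue_value N \<sigma> = 0" by (simp add: residue_value_def)
qed

lemma periodic_zero:
  fixes d :: "int \<Rightarrow> 'a :: zero"
  assumes n: "n > 0" and per: "\<And>s. d (s + n) = d s" and z: "\<And>s. 1 \<le> s \<Longrightarrow> s \<le> n \<Longrightarrow> d s = 0"
  shows "d s = 0"
proof -
  have nat: "d (s + int k * n) = d s" for s k
  proof (induction k)
    case (Suc k)
    have "s + int (Suc k) * n = s + int k * n + n" by (simp add: algebra_simps)
    with Suc per show ?case by metis
  qed simp
  have eq: "d (s + k * n) = d s" for s k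
    using nat[of s "nat k"] nat[of "s + k * n" "nat (-k)"] by (cases "k \<ge> 0") auto
  \<comment> \<open>Shifting by one before reducing puts the representative in 1, ..., n instead of
    0, ..., n - 1.\<close>
  have "s = 1 + (s - 1) mod n + ((s - 1) div n) * n"
    by (simp add: algebra_simps)
  then have "d s = d (1 + (s - 1) mod n)" by (metis eq)
  also have "\<dots> = 0"
    using n pos_mod_bound[OF n, of "s - 1"] pos_mod_sign[OF n, of "s - 1"] by (intro z) linarith+
  finally show ?thesis .
qed

section \<open>Residues at the Farey fractions\<close>

text \<open>The margin \<open>1 / (N + 1)\<close> to the left of \<open>0\<close> contains no pole of \<open>Q N \<sigma>\<close>, which leaves room for
  the left side of the contour, while its translate by \<open>1\<close> still passes to the right of every Farey fraction.\<close>

definition strip :: "nat \<Rightarrow> complex set" where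
  "strip N = {z. - (1 / (real N + 1)) < Re z \<and> Re z < 1}"

lemma open_strip: "open (strip N)"
  unfolding strip_def Collect_conj_eq by (intro open_Int open_halfspace_Re_lt open_halfspace_Re_gt)

lemma convex_strip: "convex (strip N)"
  unfolding strip_def Collect_conj_eq by (intro convex_Int convex_halfspace_Re_lt convex_halfspace_Re_gt)

lemma strip_Suc: "strip (Suc N) \<subseteq> strip N"
proof -
  have "1 / (real (Suc N) + 1) \<le> 1 / (real N + 1)" by (intro divide_left_mono) auto
  then show ?thesis by (auto simp: strip_def)
qed

lemma farey_bounds:
  assumes "x \<in> farey N"
  shows "0 \<le> x" "x \<le> 1 - 1 / (real N + 1)"
proof -
  from assms obtain h k where x: "x = real h / real k" "1 \<le> k" "k \<le> N" "h < k"
    by (auto simp: farey_def)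
  then show "0 \<le> x" by simp
  have "x \<le> (real k - 1) / real k"
    unfolding x using x by (intro divide_right_mono) auto
  also have "\<dots> = 1 - 1 / real k" using x by (simp add: field_simps)
  also have "\<dots> \<le> 1 - 1 / (real N + 1)"
    using x by (intro diff_left_mono divide_left_mono) auto
  finally show "x \<le> 1 - 1 / (real N + 1)" .
qed

lemma farey_mono: "M \<le> N \<Longrightarrow> farey M \<subseteq> farey N"
  by (force simp: farey_def)

lemma fraction_in_farey:
  assumes "1 \<le> j" "j \<le> N" "n < j"
  shows "real n / real j \<in> farey N"
proof -
  have "gcd n j \<noteq> 0" using assms by simp
  then obtain h k where hk: "n = h * gcd n j" "j = k * gcd n j" "coprime h k"
    using gcd_coprime_exists by blast
  define d where "d = gcd n j"
  have nj: "n = h * d" "j = k * d" using hk by (auto simp: d_def)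
  then have "d > 0" "k > 0" "h < k" using assms by (auto intro: gr0I)
  moreover have "real n / real j = real h / real k" using nj \<open>d > 0\<close> by simp
  moreover have "k \<le> N"
  proof -
    have "k * 1 \<le> k * d" using \<open>d > 0\<close> by (intro mult_le_mono2) simp
    with nj assms show ?thesis by linarith
  qed
  ultimately show ?thesis using hk(3) unfolding farey_def by (intro CollectI exI[of _ h] exI[of _ k]) simp
qed

lemma farey_1: "farey 1 = {0}"
proof
  show "farey 1 \<subseteq> {0}" by (auto simp: farey_def)
  show "{0} \<subseteq> farey 1" using fraction_in_farey[of 1 1 0] by simp
qed

text \<open>The equation makes j z an integer n, so z is real. As j/(N + 1) < 1, the left margin of
  the strip excludes n \<le> -1, and Re z < 1 gives n < j.\<close>

lemma pole_in_farey:
  assumes z: "z \<in> strip N" and j: "1 \<le> j" "j \<le> N"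
    and e: "exp (2 * of_real pi * \<i> * of_nat j * z) = 1"
  shows "z \<in> complex_of_real ` farey N"
proof -
  from e obtain n :: int where n: "real j * Im z = 0" "2 * pi * (real j * Re z) = 2 * pi * of_int n"
    by (auto simp: exp_eq_1 mult_ac)
  then have Im: "Im z = 0" and Re: "real j * Re z = of_int n" using j by auto
  have "real j * (1 / (real N + 1)) < 1" using j by (simp add: field_simps)
  moreover have "real j * - (1 / (real N + 1)) < real j * Re z"
    using z j by (intro mult_strict_left_mono) (auto simp: strip_def)
  ultimately have "real_of_int n > -1" unfolding Re mult_minus_right by linarith
  then have n0: "n \<ge> 0" by linarith
  have "real j * Re z < real j * 1"
    using z j by (intro mult_strict_left_mono) (auto simp: strip_def)
  then have "n < int j" unfolding Re by simp
  with n0 j have "real (nat n) / real j \<in> farey N"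
    by (intro fraction_in_farey) auto
  moreover have "z = of_real (real (nat n) / real j)"
    using Im Re j n0 by (simp add: complex_eq_iff field_simps)
  ultimately show ?thesis by blast
qed

lemma Q_holomorphic: "Q N \<sigma> holomorphic_on strip N - complex_of_real ` farey N"
  unfolding Q_def
  by (intro holomorphic_intros) (use pole_in_farey in fastforce)

lemma Q_periodic: "Q N \<sigma> (z + 1) = Q N \<sigma> z"
proof -
  have *: "exp (2 * of_real pi * \<i> * of_int a * (z + 1)) = exp (2 * of_real pi * \<i> * of_int a * z)"
    for a
  proof -
    have "exp (2 * of_real pi * \<i> * of_int a * (z + 1))
        = exp (2 * of_real pi * \<i> * of_int a * z) * exp (of_real (2 * of_int a * pi) * \<i>)"
      unfolding exp_add[symmetric] by (intro arg_cong[of _ _ exp]) (simp add: algebra_simps)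
    with exp_integer_2pi[of "of_int a"] show ?thesis by simp
  qed
  from *[of \<sigma>] *[of "int _"] show ?thesis by (simp add: Q_def)
qed

section \<open>Recurrence for the residue sum\<close>

text \<open>Shifting \<sigma> by N + 1 multiplies \<open>Q\<close> by an exponential, and the
  difference cancels the last factor of the product. At a zero of that factor both terms on the left
  are 0 by \<open>inverse 0 = 0\<close>, hence the hypothesis.\<close>

lemma Q_diff:
  assumes "exp (2 * of_real pi * \<i> * of_nat (Suc N) * z) \<noteq> 1"
  shows "Q (Suc N) \<sigma> z - Q (Suc N) (\<sigma> + int (Suc N)) z = Q N \<sigma> z"
proof -
  have "exp (2 * of_real pi * \<i> * of_int (\<sigma> + int (Suc N)) * z) =
    exp (2 * of_real pi * \<i> * of_int \<sigma> * z) * exp (2 * of_real pi * \<i> * of_nat (Suc N) * z)"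
    by (simp add: algebra_simps flip: exp_add)
  then have "Q (Suc N) \<sigma> z - Q (Suc N) (\<sigma> + int (Suc N)) z =
    Q N \<sigma> z * ((1 - exp (2 * of_real pi * \<i> * of_nat (Suc N) * z)) *
      inverse (1 - exp (2 * of_real pi * \<i> * of_nat (Suc N) * z)))"
    unfolding Q_def by (simp add: algebra_simps del: of_nat_Suc)
  with assms show ?thesis by simp
qed

definition residue_sum :: "nat \<Rightarrow> int \<Rightarrow> complex" where
  "residue_sum N \<sigma> = (\<Sum>x\<in>farey N. residue (Q N \<sigma>) (complex_of_real x))"

lemma farey_in_strip: "x \<in> farey N \<Longrightarrow> complex_of_real x \<in> strip N"
proof -
  assume "x \<in> farey N"
  moreover have "0 < 1 / (real N + 1)" by simp
  ultimately show ?thesis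
    using farey_bounds[of x N] unfolding strip_def mem_Collect_eq Re_complex_of_real by linarith
qed

lemma open_strip_diff_finite: "finite A \<Longrightarrow> open (strip N - A)"
  by (intro open_Diff open_strip finite_imp_closed)

lemma residue_sum_diff:
  "residue_sum (Suc N) \<sigma> - residue_sum (Suc N) (\<sigma> + int (Suc N)) = residue_sum N \<sigma>"
proof -
  let ?P = "\<lambda>N. complex_of_real ` farey N"
  have res: "residue (Q (Suc N) \<sigma>) (of_real x) - residue (Q (Suc N) (\<sigma> + int (Suc N))) (of_real x)
      = residue (Q N \<sigma>) (of_real x)" if x: "x \<in> farey (Suc N)" for x
  proof -
    \<comment> \<open>All other Farey points are removed, so that x is the only possible singularity
      in \<open>s\<close>.\<close>
    define s where "s = strip (Suc N) - (?P (Suc N) - {of_real x})"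
    have s: "open s" "of_real x \<in> s"
      using farey_in_strip[OF x] unfolding s_def
      by (auto intro!: open_strip_diff_finite finite_farey)
    have sub: "s - {of_real x} \<subseteq> strip (Suc N) - ?P (Suc N)" by (auto simp: s_def)
    have "residue (\<lambda>z. Q (Suc N) \<sigma> z - Q (Suc N) (\<sigma> + int (Suc N)) z) (of_real x) =
      residue (Q (Suc N) \<sigma>) (of_real x) - residue (Q (Suc N) (\<sigma> + int (Suc N))) (of_real x)"
      by (intro residue_diff[OF s] holomorphic_on_subset[OF Q_holomorphic sub])
    moreover have "residue (\<lambda>z. Q (Suc N) \<sigma> z - Q (Suc N) (\<sigma> + int (Suc N)) z) (of_real x) =
      residue (Q N \<sigma>) (of_real x)"
    proof (rule residue_cong)
      have "eventually (\<lambda>z. z \<in> s - {of_real x}) (at (of_real x))"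
        using s by (intro eventually_at_in_open) auto
      then show "\<forall>\<^sub>F z in at (complex_of_real x).
          Q (Suc N) \<sigma> z - Q (Suc N) (\<sigma> + int (Suc N)) z = Q N \<sigma> z"
      proof eventually_elim
        case (elim z)
        then have "z \<in> strip (Suc N)" "z \<notin> ?P (Suc N)" using sub by auto
        then show ?case
          using pole_in_farey[of z "Suc N" "Suc N"] by (intro Q_diff) auto
      qed
    qed simp
    ultimately show ?thesis by simp
  qed
  have "residue_sum (Suc N) \<sigma> - residue_sum (Suc N) (\<sigma> + int (Suc N)) =
    (\<Sum>x\<in>farey (Suc N). residue (Q N \<sigma>) (of_real x))"
    unfolding residue_sum_def by (simp add: res flip: sum_subtractf del: of_nat_Suc)
  also have "\<dots> = residue_sum N \<sigma>"
    unfolding residue_sum_def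
  proof (rule sum.mono_neutral_right)
    \<comment> \<open>At the fractions new in order N + 1 the function \<open>Q N \<sigma>\<close>
      is still holomorphic.\<close>
    show "\<forall>x\<in>farey (Suc N) - farey N. residue (Q N \<sigma>) (of_real x) = 0"
    proof
      fix x assume x: "x \<in> farey (Suc N) - farey N"
      then have "of_real x \<in> strip N - ?P N"
        using farey_in_strip strip_Suc by fastforce
      then show "residue (Q N \<sigma>) (of_real x) = 0"
        by (intro residue_holo[OF open_strip_diff_finite _ Q_holomorphic])
          (auto intro: finite_farey)
    qed
  qed (auto simp: finite_farey intro: farey_mono[THEN subsetD, rotated])
  finally show ?thesis .
qed

text \<open>The only pole is simple and lies at 0, where the denominator has derivative -2 pi i.
  This value anchors the base case.\<close>

lemma residue_sum_1_1: "2 * of_real pi * \<i> * residue_sum 1 1 = -1"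
proof -
  define e where "e = (\<lambda>z. exp (2 * of_real pi * \<i> * z))"
  have "residue (\<lambda>z. e z / (1 - e z)) 0 = e 0 / (- (2 * of_real pi * \<i>))"
  proof (rule residue_simple_pole_deriv[where s = UNIV])
    show "((\<lambda>z. 1 - e z) has_field_derivative - (2 * of_real pi * \<i>)) (at 0)"
      unfolding e_def by (auto intro!: derivative_eq_intros)
  qed (auto simp: e_def intro!: holomorphic_intros)
  moreover have "Q 1 1 = (\<lambda>z. e z / (1 - e z))"
    by (auto simp: Q_def e_def field_simps)
  ultimately show ?thesis by (simp add: residue_sum_def farey_1[simplified] e_def)
qed

section \<open>Decay of \<open>Q\<close> far from the real axis\<close>

text \<open>In terms of w, \<open>Q\<close> is a rational function, and Im z tending to plus or
  minus infinity becomes w tending to 0 or to infinity.\<close>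

lemma Q_eq_powi:
  defines "w \<equiv> \<lambda>z. exp (2 * of_real pi * \<i> * z)"
  shows "Q N \<sigma> z = w z powi \<sigma> * (\<Prod>j=1..N. inverse (1 - w z ^ j))"
proof -
  have "exp (2 * of_real pi * \<i> * of_nat j * z) = w z ^ j" for j
    by (simp add: w_def mult_ac flip: exp_of_nat_mult)
  moreover have "exp (2 * of_real pi * \<i> * of_int \<sigma> * z) = w z powi \<sigma>"
    using exp_power_int[of "2 * of_real pi * \<i> * z" \<sigma>] by (simp add: w_def mult_ac)
  ultimately show ?thesis by (simp add: Q_def)
qed

text \<open>Here |w| \<le> 1/2, so every factor of the product is at most 2, and \<sigma> \<ge> 1
  leaves at least one power of |w|.\<close>

lemma norm_Q_upper:
  assumes s: "\<sigma> \<ge> 1" and v: "exp (- (2 * pi * Im z)) \<le> 1 / 2"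
  shows "norm (Q N \<sigma> z) \<le> 2 ^ N * exp (- (2 * pi * Im z))"
proof -
  define w where "w = exp (2 * of_real pi * \<i> * z)"
  have nw: "norm w = exp (- (2 * pi * Im z))" by (simp add: w_def norm_exp_eq_Re)
  have w_le: "norm w \<le> 1 / 2" using v by (simp add: nw)
  have "norm (inverse (1 - w ^ j)) \<le> 2" if "j \<in> {1..N}" for j
  proof -
    have "norm w ^ j \<le> norm w ^ 1"
      using that w_le by (intro power_decreasing) auto
    with w_le have "norm (w ^ j) \<le> 1 / 2" by (simp add: norm_power)
    then have "1 / 2 \<le> norm (1 - w ^ j)"
      using norm_triangle_ineq2[of 1 "w ^ j"] by simp
    then have "inverse (norm (1 - w ^ j)) \<le> inverse (1 / 2)" by (intro le_imp_inverse_le) auto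
    then show ?thesis by (simp add: norm_inverse)
  qed
  then have P: "norm (\<Prod>j=1..N. inverse (1 - w ^ j)) \<le> 2 ^ N"
    using prod_mono[of "{1..N}" "\<lambda>j. norm (inverse (1 - w ^ j))" "\<lambda>_. 2"]
    by (simp add: prod_norm)
  have "norm (w powi \<sigma>) = norm w ^ nat \<sigma>"
    using s by (simp add: norm_power_int power_int_def norm_power)
  also have "\<dots> \<le> norm w ^ 1"
    using s w_le by (intro power_decreasing) auto
  finally have "norm (w powi \<sigma>) \<le> exp (- (2 * pi * Im z))" by (simp add: nw)
  with P show ?thesis
    unfolding Q_eq_powi w_def[symmetric] norm_mult mult.commute[of "2 ^ N"]
    by (intro mult_mono) auto
qed

text \<open>With r = |w| \<ge> 2, each |1 - w^j| is at least r^j / 2, so the product is at most 2^N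
  r^(-N(N+1)/2). As \<sigma> is an integer below the threshold, the total exponent of r is at most
  -1.\<close>

lemma norm_Q_lower:
  assumes s: "\<sigma> < int N * (int N + 1) div 2" and v: "exp (2 * pi * Im z) \<le> 1 / 2"
  shows "norm (Q N \<sigma> z) \<le> 2 ^ N * exp (2 * pi * Im z)"
proof -
  define w where "w = exp (2 * of_real pi * \<i> * z)"
  define r where "r = norm w"
  have r_inv: "exp (2 * pi * Im z) = inverse r"
    by (simp add: r_def w_def norm_exp_eq_Re exp_minus)
  have r0: "r > 0" by (simp add: r_def w_def)
  have r: "r \<ge> 2" using v r0 unfolding r_inv by (simp add: field_simps)
  have "norm (inverse (1 - w ^ j)) \<le> 2 * inverse r ^ j" if "j \<in> {1..N}" for j
  proof -
    have "r ^ 1 \<le> r ^ j" using that r by (intro power_increasing) auto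
    then have "r ^ j / 2 \<le> norm (1 - w ^ j)"
      using norm_triangle_ineq2[of "w ^ j" 1] r
      by (simp add: r_def norm_power norm_minus_commute)
    then have "inverse (norm (1 - w ^ j)) \<le> inverse (r ^ j / 2)"
      using r0 by (intro le_imp_inverse_le) auto
    moreover have "inverse (r ^ j / 2) = 2 * inverse r ^ j"
      by (simp add: power_inverse field_simps)
    ultimately show ?thesis by (simp add: norm_inverse)
  qed
  then have "norm (\<Prod>j=1..N. inverse (1 - w ^ j)) \<le> (\<Prod>j=1..N. 2 * inverse r ^ j)"
    unfolding prod_norm[symmetric] by (intro prod_mono) auto
  also have "\<dots> = 2 ^ N * inverse r ^ (\<Sum>j=1..N. j)"
    by (simp add: prod.distrib power_sum)
  also have "inverse r ^ (\<Sum>j=1..N. j) = r powi - int (\<Sum>j=1..N. j)"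
    by (simp add: power_int_minus power_inverse del: of_nat_sum)
  also have "int (\<Sum>j=1..N. j) = int N * (int N + 1) div 2"
    using gauss_sum_from_Suc_0[of N, where ?'a = nat] by (simp add: zdiv_int algebra_simps)
  finally have P: "norm (\<Prod>j=1..N. inverse (1 - w ^ j)) \<le> 2 ^ N * r powi - (int N * (int N + 1) div 2)" .
  have "norm (Q N \<sigma> z) \<le> r powi \<sigma> * (2 ^ N * r powi - (int N * (int N + 1) div 2))"
    unfolding Q_eq_powi w_def[symmetric] norm_mult norm_power_int r_def[symmetric]
    using r0 by (intro mult_left_mono P) auto
  also have "\<dots> = 2 ^ N * r powi (\<sigma> - int N * (int N + 1) div 2)"
    using r0 by (simp add: power_int_diff power_int_minus divide_inverse mult_ac)
  also have "\<dots> \<le> 2 ^ N * r powi (-1)"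
    using s r by (intro mult_left_mono power_int_increasing) auto
  finally show ?thesis by (simp add: r_inv power_int_minus)
qed

section \<open>Contour integration in the middle range\<close>

text \<open>A contradiction replaces the limit of growing rectangles: if the sum were nonzero, one
  rectangle tall enough would already bound it by half its own norm.\<close>

lemma residue_sum_eq_0:
  assumes s: "1 \<le> \<sigma>" "\<sigma> < int N * (int N + 1) div 2"
  shows "residue_sum N \<sigma> = 0"
proof (rule ccontr)
  define S where "S = 2 * of_real pi * \<i> * residue_sum N \<sigma>"
  assume "residue_sum N \<sigma> \<noteq> 0"
  then have S0: "norm S > 0" by (simp add: S_def)
  \<comment> \<open>The intended value of exp(-2 pi T). The cap 1/2 meets the hypotheses of the
    decay bounds; the other makes the two horizontal sides contribute at most
    \<open>norm S / 2\<close>.\<close>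
  define v where "v = min (1 / 2) (norm S / (4 * 2 ^ N))"
  have v: "0 < v" "v \<le> 1 / 2" "v \<le> norm S / (4 * 2 ^ N)" using S0 by (auto simp: v_def)
  define T where "T = - ln v / (2 * pi)"
  have T: "T > 0" "exp (- (2 * pi * T)) = v"
    using v by (auto simp: T_def field_simps)
  define c where "c = 1 / (real N + 1)"
  have c: "0 < c" "c \<le> 1" by (auto simp: c_def)
  \<comment> \<open>With c/2 in place of c, the left side lies strictly inside the strip; the right
    side, at distance 1 from it, passes to the right of all Farey fractions, which are at most 1 -
    c.\<close>
  define a1 a2 a3 a4 where a_defs: "a1 = Complex (- c / 2) (- T)" "a2 = Complex (1 - c / 2) (- T)"
    "a3 = Complex (1 - c / 2) T" "a4 = Complex (- c / 2) T"
  let ?pts = "complex_of_real ` farey N"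
  let ?D = "strip N - ?pts"
  have pts: "p \<in> box a1 a3" if "p \<in> ?pts" for p
    using that farey_bounds[of _ N] c T unfolding c_def[symmetric]
    by (fastforce simp: a_defs in_box_complex_iff)
  have cbox: "cbox a1 a3 \<subseteq> strip N"
    using c by (auto simp: a_defs in_cbox_complex_iff strip_def simp flip: c_def)
  have img: "path_image (rectpath a1 a3) = cbox a1 a3 - box a1 a3"
    using c T by (intro path_image_rectpath_cbox_minus_box) (auto simp: a_defs)
  have img_D: "path_image (rectpath a1 a3) \<subseteq> ?D"
    using pts cbox unfolding img by blast
  have rect: "rectpath a1 a3 = linepath a1 a2 +++ linepath a2 a3 +++ linepath a3 a4 +++ linepath a4 a1"
    by (simp add: rectpath_def a_defs Let_def)
  have segs: "closed_segment a1 a2 \<subseteq> ?D" "closed_segment a2 a3 \<subseteq> ?D"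
    "closed_segment a3 a4 \<subseteq> ?D" "closed_segment a4 a1 \<subseteq> ?D"
    using img_D unfolding rect by (auto simp: path_image_join)
  have cont: "continuous_on A (Q N \<sigma>)" if "A \<subseteq> ?D" for A
    by (intro holomorphic_on_imp_continuous_on holomorphic_on_subset[OF Q_holomorphic that])
  note int = segs[THEN cont, THEN contour_integrable_continuous_linepath]
  have "contour_integral (rectpath a1 a3) (Q N \<sigma>) =
    2 * pi * \<i> * (\<Sum>p\<in>?pts. winding_number (rectpath a1 a3) p * residue (Q N \<sigma>) p)"
  proof (rule Residue_theorem[OF open_strip convex_connected[OF convex_strip] _ Q_holomorphic _ _ img_D])
    show "\<forall>z. z \<notin> strip N \<longrightarrow> winding_number (rectpath a1 a3) z = 0"
      using cbox c T by (intro allI impI winding_number_rectpath_outside) (auto simp: a_defs)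
  qed (auto simp: finite_farey)
  also have "(\<Sum>p\<in>?pts. winding_number (rectpath a1 a3) p * residue (Q N \<sigma>) p) =
    (\<Sum>p\<in>?pts. residue (Q N \<sigma>) p)"
    by (intro sum.cong refl) (simp add: winding_number_rectpath pts)
  also have "\<dots> = residue_sum N \<sigma>"
    unfolding residue_sum_def by (subst sum.reindex) (auto simp: inj_on_def)
  finally have "S = contour_integral (rectpath a1 a3) (Q N \<sigma>)" by (simp add: S_def)
  also have "\<dots> = contour_integral (linepath a1 a2) (Q N \<sigma>) + contour_integral (linepath a2 a3) (Q N \<sigma>)
    + contour_integral (linepath a3 a4) (Q N \<sigma>) + contour_integral (linepath a4 a1) (Q N \<sigma>)"
    unfolding rect using int by (simp add: contour_integrable_joinI valid_path_join)
  \<comment> \<open>The right side is the reversed left side translated by 1, so periodicity cancels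
    the vertical contributions.\<close>
  also have "linepath a2 a3 = (+) 1 \<circ> linepath a1 a4"
    by (auto simp: linepath_def a_defs complex_eq_iff algebra_simps)
  also have "contour_integral \<dots> (Q N \<sigma>) = contour_integral (linepath a1 a4) (Q N \<sigma>)"
    by (simp add: contour_integral_translate Q_periodic)
  also have "\<dots> = - contour_integral (linepath a4 a1) (Q N \<sigma>)"
    using segs(4) by (intro contour_integral_reverse_linepath cont) (simp add: closed_segment_commute)
  finally have S_eq: "S = contour_integral (linepath a1 a2) (Q N \<sigma>)
    + contour_integral (linepath a3 a4) (Q N \<sigma>)" by simp
  have "norm (contour_integral (linepath a1 a2) (Q N \<sigma>)) \<le> 2 ^ N * v * norm (a2 - a1)"
  proof (rule contour_integral_bound_linepath[OF int(1)])
    fix z assume "z \<in> closed_segment a1 a2"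
    then have "Im z = - T" by (auto simp: a_defs closed_segment_same_Im)
    then show "norm (Q N \<sigma> z) \<le> 2 ^ N * v" using norm_Q_lower[OF s(2), of z] T v by simp
  qed (use v in auto)
  moreover have "norm (contour_integral (linepath a3 a4) (Q N \<sigma>)) \<le> 2 ^ N * v * norm (a4 - a3)"
  proof (rule contour_integral_bound_linepath[OF int(3)])
    fix z assume "z \<in> closed_segment a3 a4"
    then have "Im z = T" by (auto simp: a_defs closed_segment_same_Im)
    then show "norm (Q N \<sigma> z) \<le> 2 ^ N * v" using norm_Q_upper[OF s(1), of z] T v by simp
  qed (use v in auto)
  moreover have "norm (a2 - a1) = 1" "norm (a4 - a3) = 1"
    by (auto simp: a_defs cmod_def)
  ultimately have "norm S \<le> 2 * (2 ^ N * v)"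
    unfolding S_eq by (intro order_trans[OF norm_triangle_ineq]) simp
  also have "\<dots> \<le> 2 * (2 ^ N * (norm S / (4 * 2 ^ N)))"
    using v by (intro mult_left_mono) auto
  finally show False using S0 by simp
qed

section \<open>Induction on \<open>N\<close>\<close>

lemma residue_sum_eq_residue_value:
  assumes "N \<ge> 1"
  shows "2 * of_real pi * \<i> * residue_sum N \<sigma> = of_int (residue_value N \<sigma>)"
  using assms
proof (induction N arbitrary: \<sigma> rule: nat_induct_at_least)
  case base
  define d where "d = (\<lambda>s. 2 * of_real pi * \<i> * residue_sum 1 s + 1)"
  \<comment> \<open>\<open>farey 0\<close> is empty, so the recurrence from order 0 makes
    \<open>residue_sum 1\<close> constant, and its value at 1 settles the case.\<close>
  have "residue_sum 1 s - residue_sum 1 (s + 1) = 0" for s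
    using residue_sum_diff[of 0 s] by (simp add: residue_sum_def[of 0] farey_def)
  then have "d (s + 1) = d s" for s by (simp add: d_def)
  then have "d \<sigma> = 0"
  proof (rule periodic_zero[rotated])
    show "d s = 0" if "1 \<le> s" "s \<le> 1" for s
    proof -
      from that have "s = 1" by simp
      with residue_sum_1_1 show ?thesis by (simp only: d_def) simp
    qed
  qed simp
  then show ?case unfolding residue_value_1 by (simp add: d_def add_eq_0_iff2)
next
  case (Suc N)
  define d where "d = (\<lambda>s. 2 * of_real pi * \<i> * residue_sum (Suc N) s - of_int (residue_value (Suc N) s))"
  have per: "d (s + int (Suc N)) = d s" for s
  proof -
    have "d s - d (s + int (Suc N)) =
      2 * of_real pi * \<i> * (residue_sum (Suc N) s - residue_sum (Suc N) (s + int (Suc N)))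
        - of_int (residue_value (Suc N) s - residue_value (Suc N) (s + int (Suc N)))"
      by (simp add: d_def algebra_simps del: of_nat_Suc)
    also have "\<dots> = 0"
      unfolding residue_sum_diff residue_value_diff[OF Suc.hyps] by (simp add: Suc.IH)
    finally show ?thesis by simp
  qed
  have "d \<sigma> = 0"
  proof (rule periodic_zero[where d = d, OF _ per])
    \<comment> \<open>Since N + 1 \<ge> 2, both terms of \<open>d\<close> vanish on this full
      period.\<close>
    show "d s = 0" if "1 \<le> s" "s \<le> int (Suc N)" for s
      using residue_value_middle[of "Suc N" s] residue_sum_eq_0[of s "Suc N"] that Suc.hyps
      by (simp add: d_def del: of_nat_Suc)
  qed simp
  then show ?case by (simp add: d_def)
qed

theorem theorem2p1:
  fixes N :: nat and \<sigma> :: int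
  assumes "N \<ge> 1"
  shows "2 * of_real pi * \<i> * (\<Sum>x\<in>farey N. residue (Q N \<sigma>) (complex_of_real x)) =
    (if \<sigma> \<le> 0 then - of_nat (p_at_most N (nat (- \<sigma>)))
     else if \<sigma> < int N * (int N + 1) div 2 then 0
     else (-1) ^ N * of_nat (p_at_most N (nat (\<sigma> - int N * (int N + 1) div 2))))"
  using residue_sum_eq_residue_value[OF assms, of \<sigma>]
  unfolding residue_sum_def residue_value_def by (simp split: if_splits)

end
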